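(* Let $(X,d)$ be a metric space and let $\mathfrak B$ be a bornology on $X$ with closed base such that $X\notin\mathfrak B$ and $X$ is $\mathfrak B^s$-Lindelöf. The following are equivalent: (1) $(\mathsf C(X),\tau_{\mathfrak B}^s)$ is a strictly Fréchet-Urysohn space; (2) $X$ satisfies $\mathsf S_1(\mathcal O_{\mathfrak B^s},\Gamma_{\mathfrak B^s})$.
   Context: A bornology on a metric space $(X,d)$ is a family $\mathfrak B$ of nonempty subsets of $X$ that is closed under finite unions, closed under taking nonempty subsets, and covers $X$. A base for $\mathfrak B$ is a subfamily $\mathfrak B_0\subset\mathfrak B$ such that every $B\in\mathfrak B$ is contained in some $B_0\in\mathfrak B_0$; it is a closed base if all its members are closed in $X$. For $A\subset X$ and $\varepsilon>0$, $A^{\varepsilon}=\bigcup_{a\in A}\{y\in X: d(a,y)<\varepsilon\}$. $\mathsf C(X)$ is the set of all continuous functions $X\to\mathbb R$. The topology $\tau_{\mathfrak B}^s$ of strong uniform convergence on $\mathfrak B$ is the topology on $\mathsf C(X)$ in which each $f$ has as a local base the sets $[B,\varepsilon]^s(f)=\{g\in\mathsf C(X):\exists\delta>0\ \forall x\in B^{\delta}\ |g(x)-f(x)|<\varepsilon\}$, for $B\in\mathfrak B$ and $\varepsilon>0$. A strong $\mathfrak B$-cover ($\mathfrak B^s$-cover) of $X$ is an open cover $\mathcal U$ of $X$ such that $X\notin\mathcal U$ and for each $B\in\mathfrak B$ there are $U\in\mathcal U$ and $\delta>0$ with $B^{\delta}\subset U$. $\mathcal O_{\mathfrak B^s}$ is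 the collection of all $\mathfrak B^s$-covers of $X$. $X$ is $\mathfrak B^s$-Lindelöf if every $\mathfrak B^s$-cover of $X$ contains a countable subfamily that is a $\mathfrak B^s$-cover. A countable open cover $\mathcal U=\{U_n:n\in\mathbb N\}$ of $X$ is a $\gamma_{\mathfrak B^s}$-cover if it is infinite and for each $B\in\mathfrak B$ there are $n_0\in\mathbb N$ and a sequence $(\delta_n:n\ge n_0)$ of positive reals such that $B^{\delta_n}\subset U_n$ for all $n\ge n_0$. $\Gamma_{\mathfrak B^s}$ is the collection of all $\gamma_{\mathfrak B^s}$-covers of $X$. For families $\mathfrak U,\mathfrak V$, $\mathsf S_1(\mathfrak U,\mathfrak V)$ is the statement: for each sequence $(U_n:n\in\mathbb N)$ of elements of $\mathfrak U$ there is a sequence $(u_n:n\in\mathbb N)$ with $u_n\in U_n$ for each $n$ and $\{u_n:n\in\mathbb N\}\in\mathfrak V$. For a topological space $Z$ and $z\in Z$, $\Omega_z=\{A\subset Z\setminus\{z\}: z\in\overline A\}$ and $\Sigma_z$ is the set of sequences converging to $z$. $Z$ is strictly Fréchet-Urysohn if $\mathsf S_1(\Omega_z,\Sigma_z)$ holds for each $z\in Z$, i.e. for each sequence $(A_n:n\in\mathbb N)$ of elements of $\Omega_z$ there are $a_n\in A_n$ such that the sequence $(a_n:n\in\mathbb N)$ converges to $z$. *)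

theory Defs
  imports "HOL-Analysis.Analysis"
begin

text \<open>
  The metric space \<open>X\<close> is the carrier \<open>UNIV\<close> of a type of class \<^class>\<open>metric_space\<close>; in
  particular \<open>X\<close> is nonempty.
\<close>

definition bornology :: "'a::metric_space set set \<Rightarrow> bool" where
  "bornology \<BB> \<longleftrightarrow>
     {} \<notin> \<BB> \<and>
     (\<forall>A\<in>\<BB>. \<forall>B\<in>\<BB>. A \<union> B \<in> \<BB>) \<and>
     (\<forall>B\<in>\<BB>. \<forall>A. A \<subseteq> B \<and> A \<noteq> {} \<longrightarrow> A \<in> \<BB>) \<and>
     \<Union>\<BB> = UNIV"

definition bornology_base :: "'a::metric_space set set \<Rightarrow> 'a set set \<Rightarrow> bool" where
  "bornology_base \<BB> \<BB>0 \<longleftrightarrow> \<BB>0 \<subseteq> \<BB> \<and> (\<forall>B\<in>\<BB>. \<exists>B0\<in>\<BB>0. B \<subseteq> B0)"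

definition has_closed_base :: "'a::metric_space set set \<Rightarrow> bool" where
  "has_closed_base \<BB> \<longleftrightarrow> (\<exists>\<BB>0. bornology_base \<BB> \<BB>0 \<and> (\<forall>B\<in>\<BB>0. closed B))"

definition enlargement :: "'a::metric_space set \<Rightarrow> real \<Rightarrow> 'a set" where
  "enlargement A \<epsilon> = (\<Union>a\<in>A. ball a \<epsilon>)"


definition cont_funs :: "('a::metric_space \<Rightarrow> real) set" where
  "cont_funs = {f. continuous_on UNIV f}"

definition strong_nbhd :: "'a::metric_space set \<Rightarrow> real \<Rightarrow> ('a \<Rightarrow> real) \<Rightarrow> ('a \<Rightarrow> real) set" where
  "strong_nbhd B \<epsilon> f =
     {g \<in> cont_funs. \<exists>\<delta>>0. \<forall>x\<in>enlargement B \<delta>. \<bar>g x - f x\<bar> < \<epsilon>}"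

text \<open>
  The sets \<^const>\<open>strong_nbhd\<close> are in general not open, so they cannot be used as a subbase: a set
  is open iff it contains a basic neighbourhood of each of its points. The lemmas below confirm
  that, for a bornology, this is a topology in which the basic neighbourhoods of \<open>f\<close> form a
  local base at \<open>f\<close>.
\<close>

definition strong_topology :: "'a::metric_space set set \<Rightarrow> ('a \<Rightarrow> real) topology" where
  "strong_topology \<BB> =
     topology (\<lambda>W. W \<subseteq> cont_funs \<and> (\<forall>f\<in>W. \<exists>B\<in>\<BB>. \<exists>\<epsilon>>0. strong_nbhd B \<epsilon> f \<subseteq> W))"

lemma enlargement_mono: "A \<subseteq> B \<Longrightarrow> \<delta> \<le> \<delta>' \<Longrightarrow> enlargement A \<delta> \<subseteq> enlargement B \<delta>'"
  unfolding enlargement_def by (intro UN_mono) auto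

lemma strong_nbhd_mono:
  assumes "A \<subseteq> B" "\<epsilon> \<le> \<epsilon>'"
  shows "strong_nbhd B \<epsilon> f \<subseteq> strong_nbhd A \<epsilon>' f"
proof
  fix g assume "g \<in> strong_nbhd B \<epsilon> f"
  then obtain d where g: "g \<in> cont_funs" and d: "d > 0" "\<forall>x\<in>enlargement B d. \<bar>g x - f x\<bar> < \<epsilon>"
    unfolding strong_nbhd_def by blast
  have "\<bar>g x - f x\<bar> < \<epsilon>'" if "x \<in> enlargement A d" for x
  proof -
    have "x \<in> enlargement B d" using that enlargement_mono[OF assms(1) order_refl] by blast
    then have "\<bar>g x - f x\<bar> < \<epsilon>" using d(2) by blast
    then show ?thesis using assms(2) by linarith
  qed
  then show "g \<in> strong_nbhd A \<epsilon>' f" using g d(1) unfolding strong_nbhd_def by blast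
qed

lemma openin_strong_topology:
  assumes "bornology \<BB>"
  shows "openin (strong_topology \<BB>) W \<longleftrightarrow>
           W \<subseteq> cont_funs \<and> (\<forall>f\<in>W. \<exists>B\<in>\<BB>. \<exists>\<epsilon>>0. strong_nbhd B \<epsilon> f \<subseteq> W)"
proof -
  let ?P = "\<lambda>W. W \<subseteq> cont_funs \<and> (\<forall>f\<in>W. \<exists>B\<in>\<BB>. \<exists>\<epsilon>>0. strong_nbhd B \<epsilon> f \<subseteq> W)"
  have "istopology ?P"
    unfolding istopology_def
  proof (intro conjI allI impI)
    fix S T assume S: "?P S" and T: "?P T"
    show "S \<inter> T \<subseteq> cont_funs" using S by blast
    show "\<forall>f\<in>S \<inter> T. \<exists>B\<in>\<BB>. \<exists>\<epsilon>>0. strong_nbhd B \<epsilon> f \<subseteq> S \<inter> T"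
    proof
      fix f assume f: "f \<in> S \<inter> T"
      obtain A a where A: "A \<in> \<BB>" "a > 0" "strong_nbhd A a f \<subseteq> S" using S f by blast
      obtain B b where B: "B \<in> \<BB>" "b > 0" "strong_nbhd B b f \<subseteq> T" using T f by blast
      have "A \<union> B \<in> \<BB>" using assms A B unfolding bornology_def by blast
      moreover have "strong_nbhd (A \<union> B) (min a b) f \<subseteq> S \<inter> T"
        using strong_nbhd_mono[of A "A \<union> B" "min a b" a f]
          strong_nbhd_mono[of B "A \<union> B" "min a b" b f] A(3) B(3) by auto
      moreover have "min a b > 0" using A B by simp
      ultimately show "\<exists>B\<in>\<BB>. \<exists>\<epsilon>>0. strong_nbhd B \<epsilon> f \<subseteq> S \<inter> T" by blast
    qed
  next
    fix K assume K: "\<forall>S\<in>K. ?P S"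
    show "\<Union>K \<subseteq> cont_funs" using K by blast
    show "\<forall>f\<in>\<Union>K. \<exists>B\<in>\<BB>. \<exists>\<epsilon>>0. strong_nbhd B \<epsilon> f \<subseteq> \<Union>K"
    proof
      fix f assume "f \<in> \<Union>K"
      then obtain S where S: "S \<in> K" "f \<in> S" by blast
      then obtain B e where "B \<in> \<BB>" "e > 0" "strong_nbhd B e f \<subseteq> S" using K by blast
      with S show "\<exists>B\<in>\<BB>. \<exists>\<epsilon>>0. strong_nbhd B \<epsilon> f \<subseteq> \<Union>K" by blast
    qed
  qed
  then show ?thesis unfolding strong_topology_def by (simp add: topology_inverse')
qed

lemma topspace_strong_topology:
  fixes \<BB> :: "'a::metric_space set set"
  assumes "bornology \<BB>"
  shows "topspace (strong_topology \<BB>) = cont_funs"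
proof
  show "topspace (strong_topology \<BB>) \<subseteq> cont_funs"
    using openin_strong_topology[OF assms, THEN iffD1, OF openin_topspace] by (rule conjunct1)
  obtain B where B: "B \<in> \<BB>" using assms unfolding bornology_def by blast
  have "strong_nbhd B 1 f \<subseteq> cont_funs" for f unfolding strong_nbhd_def by blast
  then have "openin (strong_topology \<BB>) cont_funs"
    unfolding openin_strong_topology[OF assms] using B zero_less_one by blast
  then show "cont_funs \<subseteq> topspace (strong_topology \<BB>)" by (rule openin_subset)
qed

lemma strong_nbhd_is_nbhd:
  fixes \<BB> :: "'a::metric_space set set"
  assumes \<BB>: "bornology \<BB>" and f: "f \<in> cont_funs" and B: "B \<in> \<BB>" and e: "\<epsilon> > 0"
  shows "\<exists>W. openin (strong_topology \<BB>) W \<and> f \<in> W \<and> W \<subseteq> strong_nbhd B \<epsilon> f"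
proof -
  have self: "g \<in> strong_nbhd A r g" if "g \<in> cont_funs" "r > 0"
    for A :: "'a set" and r g
    using that zero_less_one unfolding strong_nbhd_def by auto
  have tri: "strong_nbhd A s g \<subseteq> strong_nbhd A (r + s) h" if gh: "g \<in> strong_nbhd A r h"
    for A :: "'a set" and r s g h
  proof
    fix k assume k: "k \<in> strong_nbhd A s g"
    obtain a where a: "a > 0" "\<forall>x\<in>enlargement A a. \<bar>g x - h x\<bar> < r"
      using gh unfolding strong_nbhd_def by blast
    obtain b where b: "b > 0" "\<forall>x\<in>enlargement A b. \<bar>k x - g x\<bar> < s" and kc: "k \<in> cont_funs"
      using k unfolding strong_nbhd_def by blast
    have "\<bar>k x - h x\<bar> < r + s" if "x \<in> enlargement A (min a b)" for x
    proof -
      have "x \<in> enlargement A a" "x \<in> enlargement A b"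
        using that enlargement_mono[of A A "min a b" a] enlargement_mono[of A A "min a b" b] by auto
      then have "\<bar>g x - h x\<bar> < r" "\<bar>k x - g x\<bar> < s" using a b by blast+
      then show ?thesis by linarith
    qed
    moreover have "min a b > 0" using a b by simp
    ultimately show "k \<in> strong_nbhd A (r + s) h" using kc unfolding strong_nbhd_def by blast
  qed
  define W where "W = {g \<in> cont_funs. \<exists>A\<in>\<BB>. \<exists>r>0. strong_nbhd A r g \<subseteq> strong_nbhd B \<epsilon> f}"
  have "\<exists>A\<in>\<BB>. \<exists>r>0. strong_nbhd A r g \<subseteq> W" if gW: "g \<in> W" for g
  proof -
    obtain A r where A: "A \<in> \<BB>" "r > 0" "strong_nbhd A r g \<subseteq> strong_nbhd B \<epsilon> f"
      using gW unfolding W_def by blast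
    have "strong_nbhd A (r/2) g \<subseteq> W"
    proof
      fix k assume k: "k \<in> strong_nbhd A (r/2) g"
      have "strong_nbhd A (r/2) k \<subseteq> strong_nbhd B \<epsilon> f" using tri[OF k, of "r/2"] A(3) by simp
      moreover have "k \<in> cont_funs" using k unfolding strong_nbhd_def by blast
      moreover have "r/2 > 0" using A(2) by simp
      ultimately show "k \<in> W" using A(1) unfolding W_def by blast
    qed
    moreover have "r/2 > 0" using A(2) by simp
    ultimately show ?thesis using A(1) by blast
  qed
  moreover have "W \<subseteq> cont_funs" unfolding W_def by (rule Collect_restrict)
  ultimately have "openin (strong_topology \<BB>) W"
    by (simp add: openin_strong_topology[OF \<BB>])
  moreover have "f \<in> W"
    unfolding W_def by (rule CollectI, rule conjI[OF f], rule bexI[OF _ B], rule exI[of _ \<epsilon>])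
      (use e in simp)
  moreover have "W \<subseteq> strong_nbhd B \<epsilon> f"
  proof
    fix g assume "g \<in> W"
    then obtain A r where "g \<in> cont_funs" "r > 0" "strong_nbhd A r g \<subseteq> strong_nbhd B \<epsilon> f"
      unfolding W_def by blast
    then show "g \<in> strong_nbhd B \<epsilon> f" using self[of g r A] by (rule_tac subsetD)
  qed
  ultimately show ?thesis by blast
qed


definition open_cover :: "'a::metric_space set set \<Rightarrow> bool" where
  "open_cover \<U> \<longleftrightarrow> (\<forall>U\<in>\<U>. open U) \<and> \<Union>\<U> = UNIV"

definition strong_covers :: "'a::metric_space set set \<Rightarrow> 'a set set set" where
  "strong_covers \<BB> =
     {\<U>. open_cover \<U> \<and> UNIV \<notin> \<U> \<and> (\<forall>B\<in>\<BB>. \<exists>U\<in>\<U>. \<exists>\<delta>>0. enlargement B \<delta> \<subseteq> U)}"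

definition strong_Lindelof :: "'a::metric_space set set \<Rightarrow> bool" where
  "strong_Lindelof \<BB> \<longleftrightarrow>
     (\<forall>\<U>\<in>strong_covers \<BB>. \<exists>\<V>. \<V> \<subseteq> \<U> \<and> countable \<V> \<and> \<V> \<in> strong_covers \<BB>)"

text \<open>
  Being a \<open>\<gamma>\<close>-cover is a property of the family \<open>\<U>\<close>, so the enumeration is quantified
  existentially; it may have repetitions.
\<close>

definition strong_gamma_covers :: "'a::metric_space set set \<Rightarrow> 'a set set set" where
  "strong_gamma_covers \<BB> =
     {\<U>. open_cover \<U> \<and> infinite \<U> \<and>
        (\<exists>U :: nat \<Rightarrow> 'a set. \<U> = range U \<and>
           (\<forall>B\<in>\<BB>. \<exists>n0. \<exists>\<delta> :: nat \<Rightarrow> real.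
              \<forall>n\<ge>n0. \<delta> n > 0 \<and> enlargement B (\<delta> n) \<subseteq> U n))}"

definition S1 :: "'b set set \<Rightarrow> 'b set set \<Rightarrow> bool" where
  "S1 \<UU> \<VV> \<longleftrightarrow>
     (\<forall>U :: nat \<Rightarrow> 'b set. (\<forall>n. U n \<in> \<UU>) \<longrightarrow>
        (\<exists>u. (\<forall>n. u n \<in> U n) \<and> range u \<in> \<VV>))"


definition Omega_at :: "'b topology \<Rightarrow> 'b \<Rightarrow> 'b set set" where
  "Omega_at Z z = {A. A \<subseteq> topspace Z - {z} \<and> z \<in> Z closure_of A}"

text \<open>
  The target class here consists of sequences rather than of sets, so this is not an instance
  of \<^const>\<open>S1\<close>.
\<close>

definition strictly_Frechet_Urysohn :: "'b topology \<Rightarrow> bool" where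
  "strictly_Frechet_Urysohn Z \<longleftrightarrow>
     (\<forall>z\<in>topspace Z. \<forall>A :: nat \<Rightarrow> 'b set. (\<forall>n. A n \<in> Omega_at Z z) \<longrightarrow>
        (\<exists>a. (\<forall>n. a n \<in> A n) \<and> limitin Z a z sequentially))"

end

theory Submission
  imports Defs
begin

text \<open>
  Call a sequence of open sets eventually enlarging if every \<open>B \<in> \<BB>\<close> has, for almost all \<open>n\<close>, an
  enlargement contained in the \<open>n\<close>-th set. If functions \<open>g\<^sub>n\<close> converge to \<open>0\<close> and \<open>g\<^sub>n = 1\<close> off
  \<open>U\<^sub>n\<close>, then \<open>U\<^sub>n\<close> is eventually enlarging; conversely, if \<open>\<bar>g\<^sub>n - f\<bar> < 1/(n+1)\<close> on eventually
  enlarging sets, then \<open>g\<^sub>n\<close> converges to \<open>f\<close>. It remains to compare eventually enlarging selections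
  with selections whose range is a \<open>\<gamma>\<close>-cover. The enumeration witnessing a \<open>\<gamma>\<close>-cover need not be the
  selection itself, which may repeat a set infinitely often. By the Lindelof property the covers may
  be taken countable, and deleting from the \<open>n\<close>-th one the first \<open>n\<close> sets of an enumeration of them
  all leaves covers every selection of which is finite-to-one.
\<close>

definition eventually_enlarging :: "'a::metric_space set set \<Rightarrow> (nat \<Rightarrow> 'a set) \<Rightarrow> bool" where
  "eventually_enlarging \<BB> u \<longleftrightarrow>
     (\<forall>B\<in>\<BB>. \<forall>\<^sub>F n in sequentially. \<exists>\<delta>>0. enlargement B \<delta> \<subseteq> u n)"

section \<open>Bornologies, strong covers and \<gamma>-covers\<close>

lemma subset_enlargement: "\<delta> > 0 \<Longrightarrow> B \<subseteq> enlargement B \<delta>"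
  unfolding enlargement_def by force

lemma bornology_finite:
  assumes "bornology \<BB>" "finite F" "F \<noteq> {}"
  shows "F \<in> \<BB>"
  using assms(2,3)
proof (induction rule: finite_ne_induct)
  case (singleton x)
  obtain B where "B \<in> \<BB>" "x \<in> B" using assms(1) unfolding bornology_def by blast
  then show ?case using assms(1) unfolding bornology_def by blast
next
  case (insert x F)
  obtain B where "B \<in> \<BB>" "x \<in> B" using assms(1) unfolding bornology_def by blast
  then have "{x} \<in> \<BB>" using assms(1) unfolding bornology_def by blast
  then have "{x} \<union> F \<in> \<BB>" using insert assms(1) unfolding bornology_def by blast
  then show ?case by simp
qed

lemma bornology_Un_finite:
  assumes "bornology \<BB>" "B \<in> \<BB>" "finite F"
  shows "B \<union> F \<in> \<BB>"
proof (cases "F = {}")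
  case False
  then show ?thesis using bornology_finite[of \<BB> F] assms unfolding bornology_def by blast
qed (use assms in simp)

text \<open>The covering condition comes for free: singletons belong to the bornology and are
  contained in their enlargements.\<close>

lemma strong_coversI:
  assumes \<BB>: "bornology \<BB>" and op: "\<And>U. U \<in> \<U> \<Longrightarrow> open U" and "UNIV \<notin> \<U>"
    and B: "\<And>B. B \<in> \<BB> \<Longrightarrow> \<exists>U\<in>\<U>. \<exists>\<delta>>0. enlargement B \<delta> \<subseteq> U"
  shows "\<U> \<in> strong_covers \<BB>"
proof -
  have "x \<in> \<Union>\<U>" for x
  proof -
    have "{x} \<in> \<BB>" using bornology_finite[OF \<BB>] by simp
    then obtain U \<delta> where "U \<in> \<U>" "\<delta> > 0" "enlargement {x} \<delta> \<subseteq> U" using B by blast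
    then show ?thesis using subset_enlargement[of \<delta> "{x}"] by blast
  qed
  then show ?thesis using assms unfolding strong_covers_def open_cover_def by blast
qed

text \<open>Adjoin to \<open>B\<close> one missed point for each member of \<open>\<U>\<close> that
  lies in \<open>F\<close>. The bornology absorbs these finitely many points, and a member of
  \<open>\<U>\<close> containing an enlargement of the bigger set cannot lie in
  \<open>F\<close>.\<close>

lemma strong_covers_Diff_finite:
  assumes \<BB>: "bornology \<BB>" and \<U>: "\<U> \<in> strong_covers \<BB>" and F: "finite F"
  shows "\<U> - F \<in> strong_covers \<BB>"
proof (rule strong_coversI[OF \<BB>])
  show "open U" if "U \<in> \<U> - F" for U
    using that \<U> unfolding strong_covers_def open_cover_def by blast
  show "UNIV \<notin> \<U> - F" using \<U> unfolding strong_covers_def by blast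
  fix B assume B: "B \<in> \<BB>"
  have "UNIV \<notin> \<U>" using \<U> unfolding strong_covers_def by blast
  then have "\<forall>V\<in>\<U>. \<exists>x. x \<notin> V" by (metis UNIV_eq_I)
  \<comment> \<open>For \<open>V\<close> outside \<open>\<U>\<close> the value \<open>x V\<close> is
    arbitrary; it merely adds a harmless point below.\<close>
  then obtain x where x: "\<forall>V\<in>\<U>. x V \<notin> V" by metis
  have "B \<union> x ` F \<in> \<BB>" using bornology_Un_finite[OF \<BB> B] F by simp
  then obtain U \<delta> where U: "U \<in> \<U>" "\<delta> > 0" "enlargement (B \<union> x ` F) \<delta> \<subseteq> U"
    using \<U> unfolding strong_covers_def by blast
  have "U \<notin> F" using x U subset_enlargement[of \<delta> "B \<union> x ` F"] by blast
  moreover have "enlargement B \<delta> \<subseteq> U"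
    using U(3) enlargement_mono[of B "B \<union> x ` F" \<delta> \<delta>] by auto
  ultimately show "\<exists>U\<in>\<U> - F. \<exists>\<delta>>0. enlargement B \<delta> \<subseteq> U" using U by blast
qed

text \<open>With only finitely many values, one point missed by each value would form a finite set.
  That set lies in the bornology, so some \<open>u n\<close> would contain it, including the point
  that \<open>u n\<close> misses.\<close>

lemma infinite_range_eventually_enlarging:
  assumes \<BB>: "bornology \<BB>" and u: "eventually_enlarging \<BB> u" and ne: "\<And>n. u n \<noteq> UNIV"
  shows "infinite (range u)"
proof
  assume fin: "finite (range u)"
  obtain x where x: "\<And>n. x (u n) \<notin> u n" using ne by (metis UNIV_eq_I)
  have "x ` range u \<in> \<BB>" using bornology_finite[OF \<BB>] fin by simp
  then obtain n \<delta> where "\<delta> > 0" "enlargement (x ` range u) \<delta> \<subseteq> u n"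
    using u unfolding eventually_enlarging_def eventually_sequentially by blast
  then show False using x[of n] subset_enlargement[of \<delta> "x ` range u"] by blast
qed

text \<open>The sequence \<open>u\<close> serves as its own enumeration; that its terms are proper
  subsets makes its range infinite.\<close>

lemma eventually_enlarging_imp_gamma_cover:
  assumes \<BB>: "bornology \<BB>" and u: "eventually_enlarging \<BB> u"
    and op: "\<And>n. open (u n)" and ne: "\<And>n. u n \<noteq> UNIV"
  shows "range u \<in> strong_gamma_covers \<BB>"
proof -
  have ex: "\<exists>n0. \<exists>\<delta>::nat \<Rightarrow> real. \<forall>n\<ge>n0. \<delta> n > 0 \<and> enlargement B (\<delta> n) \<subseteq> u n" if B: "B \<in> \<BB>" for B
  proof -
    obtain n0 where "\<forall>n\<ge>n0. \<exists>\<delta>>0. enlargement B \<delta> \<subseteq> u n"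
      using u B unfolding eventually_enlarging_def eventually_sequentially by blast
    then show ?thesis by metis
  qed
  have "range u \<in> strong_covers \<BB>"
  proof (rule strong_coversI[OF \<BB>])
    show "\<exists>U\<in>range u. \<exists>\<delta>>0. enlargement B \<delta> \<subseteq> U" if "B \<in> \<BB>" for B
      using ex[OF that] by blast
  qed (use op ne in auto)
  then have "open_cover (range u)" unfolding strong_covers_def by blast
  then show ?thesis
    using ex infinite_range_eventually_enlarging[OF \<BB> u ne] unfolding strong_gamma_covers_def
    by blast
qed

text \<open>In the witnessing enumeration \<open>U\<close> only terms below some \<open>n0\<close>
  can fail for \<open>B\<close>. Since \<open>u\<close> is finite-to-one, it takes these finitely
  many values at finitely many indices only.\<close>

lemma gamma_cover_imp_eventually_enlarging:
  assumes u: "range u \<in> strong_gamma_covers \<BB>" and fto: "\<And>V. finite (u -` {V})"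
  shows "eventually_enlarging \<BB> u"
  unfolding eventually_enlarging_def
proof
  fix B assume B: "B \<in> \<BB>"
  obtain U :: "nat \<Rightarrow> 'a set" where U: "range u = range U"
    "\<forall>B\<in>\<BB>. \<exists>n0. \<exists>\<delta>::nat \<Rightarrow> real. \<forall>n\<ge>n0. \<delta> n > 0 \<and> enlargement B (\<delta> n) \<subseteq> U n"
    using u unfolding strong_gamma_covers_def mem_Collect_eq by (elim conjE exE)
  obtain n0 and \<delta> :: "nat \<Rightarrow> real" where n0: "\<forall>n\<ge>n0. \<delta> n > 0 \<and> enlargement B (\<delta> n) \<subseteq> U n"
    using U(2) B by blast
  have "finite (\<Union>m<n0. u -` {U m})" using fto by simp
  moreover have "{n. \<not> (\<exists>\<delta>>0. enlargement B \<delta> \<subseteq> u n)} \<subseteq> (\<Union>m<n0. u -` {U m})"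
  proof
    fix n assume n: "n \<in> {n. \<not> (\<exists>\<delta>>0. enlargement B \<delta> \<subseteq> u n)}"
    obtain m where m: "u n = U m" using U(1) by blast
    have "m < n0" using n n0 m by (metis (mono_tags, lifting) mem_Collect_eq not_less)
    then show "n \<in> (\<Union>m<n0. u -` {U m})" using m by blast
  qed
  ultimately show "\<forall>\<^sub>F n in sequentially. \<exists>\<delta>>0. enlargement B \<delta> \<subseteq> u n"
    unfolding cofinite_eq_sequentially[symmetric] eventually_cofinite by (rule rev_finite_subset)
qed

lemma S1_imp_eventually_enlarging_selection:
  assumes \<BB>: "bornology \<BB>" and L: "strong_Lindelof \<BB>"
    and S: "S1 (strong_covers \<BB>) (strong_gamma_covers \<BB>)"
    and U: "\<And>n::nat. \<U> n \<in> strong_covers \<BB>"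
  shows "\<exists>u. (\<forall>n. u n \<in> \<U> n) \<and> eventually_enlarging \<BB> u"
proof -
  have "\<forall>n. \<exists>\<V>. \<V> \<subseteq> \<U> n \<and> countable \<V> \<and> \<V> \<in> strong_covers \<BB>"
    using L U unfolding strong_Lindelof_def by blast
  then obtain \<V> where V: "\<And>n. \<V> n \<subseteq> \<U> n" "\<And>n. countable (\<V> n)" "\<And>n. \<V> n \<in> strong_covers \<BB>"
    by metis
  \<comment> \<open>One numbering is shared by all the subcovers, so the number of a set does not
    depend on the cover it is selected from.\<close>
  define h where "h = to_nat_on (\<Union>n. \<V> n)"
  have "inj_on h (\<Union>n. \<V> n)" unfolding h_def using V(2) by (intro inj_on_to_nat_on) blast
  then have inj: "inj_on h (\<V> n)" for n by (rule inj_on_subset) blast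
  define W where "W n = \<V> n - {V\<in>\<V> n. h V < n}" for n
  have "finite {V\<in>\<V> n. h V < n}" for n
    by (rule inj_on_finite[of h _ "{..<n}"]) (auto intro: inj_on_subset[OF inj[of n]])
  then have "W n \<in> strong_covers \<BB>" for n
    unfolding W_def using strong_covers_Diff_finite[OF \<BB> V(3)] by blast
  then obtain u where u: "\<And>n. u n \<in> W n" "range u \<in> strong_gamma_covers \<BB>"
    using S unfolding S1_def by metis
  \<comment> \<open>Selection from \<open>W n\<close> forces \<open>n \<le> h (u n)\<close>, so
    \<open>V\<close> can occur only at indices up to \<open>h V\<close>.\<close>
  have "finite (u -` {V})" for V
  proof (rule finite_subset[of _ "{..h V}"])
    show "u -` {V} \<subseteq> {..h V}" using u(1) unfolding W_def by (auto simp: not_less)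
  qed simp
  then have "eventually_enlarging \<BB> u" using gamma_cover_imp_eventually_enlarging[OF u(2)] by blast
  moreover have "u n \<in> \<U> n" for n using u(1)[of n] V(1)[of n] unfolding W_def by blast
  ultimately show ?thesis by blast
qed

section \<open>Convergence and closure in the strong topology; cutoff functions\<close>

lemma limitin_strong_topology:
  assumes \<BB>: "bornology \<BB>" and f: "f \<in> cont_funs"
  shows "limitin (strong_topology \<BB>) g f sequentially \<longleftrightarrow>
           (\<forall>B\<in>\<BB>. \<forall>\<epsilon>>0. \<forall>\<^sub>F n in sequentially. g n \<in> strong_nbhd B \<epsilon> f)" (is "?L \<longleftrightarrow> ?R")
proof
  assume L: ?L
  show ?R
  proof (intro ballI allI impI)
    fix B and \<epsilon> :: real assume "B \<in> \<BB>" "\<epsilon> > 0"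
    \<comment> \<open>Basic neighbourhoods need not be open, so an open set inside is used; the
      closure lemma below does the same.\<close>
    then obtain W where W: "openin (strong_topology \<BB>) W" "f \<in> W" "W \<subseteq> strong_nbhd B \<epsilon> f"
      using strong_nbhd_is_nbhd[OF \<BB> f] by blast
    then have "\<forall>\<^sub>F n in sequentially. g n \<in> W" using L unfolding limitin_def by blast
    then show "\<forall>\<^sub>F n in sequentially. g n \<in> strong_nbhd B \<epsilon> f"
      by (rule eventually_mono) (use W in blast)
  qed
next
  assume R: ?R
  show ?L unfolding limitin_def topspace_strong_topology[OF \<BB>]
  proof (intro conjI f allI impI)
    fix W assume "openin (strong_topology \<BB>) W \<and> f \<in> W"
    then obtain B \<epsilon> where B: "B \<in> \<BB>" "\<epsilon> > 0" "strong_nbhd B \<epsilon> f \<subseteq> W"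
      unfolding openin_strong_topology[OF \<BB>] by blast
    then have "\<forall>\<^sub>F n in sequentially. g n \<in> strong_nbhd B \<epsilon> f" using R by blast
    then show "\<forall>\<^sub>F n in sequentially. g n \<in> W" by (rule eventually_mono) (use B in blast)
  qed
qed

lemma Omega_at_strong_topology:
  assumes \<BB>: "bornology \<BB>" and f: "f \<in> cont_funs"
  shows "A \<in> Omega_at (strong_topology \<BB>) f \<longleftrightarrow>
           A \<subseteq> cont_funs - {f} \<and> (\<forall>B\<in>\<BB>. \<forall>\<epsilon>>0. \<exists>g\<in>A. g \<in> strong_nbhd B \<epsilon> f)"
proof -
  have "f \<in> strong_topology \<BB> closure_of A \<longleftrightarrow> (\<forall>B\<in>\<BB>. \<forall>\<epsilon>>0. \<exists>g\<in>A. g \<in> strong_nbhd B \<epsilon> f)"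
    (is "?L \<longleftrightarrow> ?R")
  proof
    assume L: ?L
    show ?R
    proof (intro ballI allI impI)
      fix B and \<epsilon> :: real assume "B \<in> \<BB>" "\<epsilon> > 0"
      then obtain W where "openin (strong_topology \<BB>) W" "f \<in> W" "W \<subseteq> strong_nbhd B \<epsilon> f"
        using strong_nbhd_is_nbhd[OF \<BB> f] by blast
      then show "\<exists>g\<in>A. g \<in> strong_nbhd B \<epsilon> f" using L unfolding in_closure_of by blast
    qed
  next
    assume R: ?R
    show ?L unfolding in_closure_of topspace_strong_topology[OF \<BB>]
    proof (intro conjI f allI impI)
      fix W assume "f \<in> W \<and> openin (strong_topology \<BB>) W"
      then obtain B \<epsilon> where "B \<in> \<BB>" "\<epsilon> > 0" "strong_nbhd B \<epsilon> f \<subseteq> W"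
        unfolding openin_strong_topology[OF \<BB>] by blast
      then show "\<exists>y. y \<in> A \<and> y \<in> W" using R by blast
    qed
  qed
  then show ?thesis unfolding Omega_at_def topspace_strong_topology[OF \<BB>] by blast
qed

lemma bornology_enlargement_avoids_point:
  assumes "has_closed_base \<BB>" "UNIV \<notin> \<BB>" "B \<in> \<BB>"
  shows "\<exists>x. \<exists>\<delta>>0. x \<notin> enlargement B \<delta>"
proof -
  \<comment> \<open>\<open>B\<close> itself may be dense; a closed superset in the bornology is
    still not the whole space, so its complement contains a ball.\<close>
  obtain C where C: "C \<in> \<BB>" "closed C" "B \<subseteq> C"
    using assms(1,3) unfolding has_closed_base_def bornology_base_def by blast
  then obtain x where "x \<in> - C" using assms(2) by (metis ComplI UNIV_eq_I)
  moreover have "open (- C)" using C by (simp add: open_closed)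
  ultimately obtain \<delta> where \<delta>: "\<delta> > 0" "ball x \<delta> \<subseteq> - C" by (meson open_contains_ball)
  then have "x \<notin> enlargement B \<delta>"
    using C(3) unfolding enlargement_def by (auto simp: subset_eq dist_commute)
  then show ?thesis using \<delta>(1) by blast
qed

lemma enlargement_cutoff_function:
  assumes "B \<noteq> {}" "\<delta> > 0"
  shows "\<exists>f\<in>cont_funs. (\<forall>x\<in>enlargement B (\<delta>/2). f x = 0) \<and> (\<forall>x. x \<notin> enlargement B \<delta> \<longrightarrow> f x = 1)"
proof -
  \<comment> \<open>Linear in the distance to \<open>B\<close> between \<delta>/2 and \<delta>,
    truncated to [0,1]. Nonemptiness of \<open>B\<close> matters because \<open>infdist x {}\<close>
    is 0.\<close>
  define f where "f x = max 0 (min 1 (2 * infdist x B / \<delta> - 1))" for x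
  have "f \<in> cont_funs" unfolding cont_funs_def f_def
    using assms by (intro CollectI continuous_intros) simp
  moreover have "f x = 0" if x: "x \<in> enlargement B (\<delta>/2)" for x
  proof -
    obtain b where "b \<in> B" "dist b x < \<delta>/2" using x unfolding enlargement_def by auto
    then have "infdist x B < \<delta>/2" using infdist_le[of b B x] by (simp add: dist_commute)
    then show ?thesis using assms unfolding f_def by (simp add: field_simps)
  qed
  moreover have "f x = 1" if "x \<notin> enlargement B \<delta>" for x
  proof -
    have "\<delta> \<le> dist x b" if "b \<in> B" for b
      using that \<open>x \<notin> enlargement B \<delta>\<close> unfolding enlargement_def by (force simp: dist_commute)
    then have "\<delta> \<le> infdist x B" using assms(1) by (auto simp: infdist_def intro: cINF_greatest)
    then show ?thesis using assms unfolding f_def by (simp add: field_simps)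
  qed
  ultimately show ?thesis by blast
qed

section \<open>The two implications\<close>

lemma strictly_Frechet_Urysohn_imp_S1:
  assumes \<BB>: "bornology \<BB>" and FU: "strictly_Frechet_Urysohn (strong_topology \<BB>)"
  shows "S1 (strong_covers \<BB>) (strong_gamma_covers \<BB>)"
  unfolding S1_def
proof (intro allI impI)
  fix \<U> :: "nat \<Rightarrow> 'a set set" assume U: "\<forall>n. \<U> n \<in> strong_covers \<BB>"
  define A where "A n = {f \<in> cont_funs. \<exists>U\<in>\<U> n. \<forall>x. x \<notin> U \<longrightarrow> f x = 1}" for n
  let ?z = "(\<lambda>_. 0) :: 'a \<Rightarrow> real"
  have z: "?z \<in> cont_funs" unfolding cont_funs_def by simp
  have "A n \<in> Omega_at (strong_topology \<BB>) ?z" for n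
    unfolding Omega_at_strong_topology[OF \<BB> z]
  proof (intro conjI ballI allI impI)
    have "UNIV \<notin> \<U> n" using U unfolding strong_covers_def by blast
    then have "\<exists>x. x \<notin> U" if "U \<in> \<U> n" for U using that by (metis UNIV_eq_I)
    then have "?z \<notin> A n" unfolding A_def by auto
    then show "A n \<subseteq> cont_funs - {?z}" unfolding A_def by blast
    fix B and \<epsilon> :: real assume B: "B \<in> \<BB>" and \<epsilon>: "\<epsilon> > 0"
    have "B \<noteq> {}" using B \<BB> unfolding bornology_def by blast
    obtain U \<delta> where U: "U \<in> \<U> n" "\<delta> > 0" "enlargement B \<delta> \<subseteq> U"
      using U B unfolding strong_covers_def by blast
    obtain f where f: "f \<in> cont_funs" "\<forall>x\<in>enlargement B (\<delta>/2). f x = 0"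
      "\<forall>x. x \<notin> enlargement B \<delta> \<longrightarrow> f x = 1"
      using enlargement_cutoff_function[OF \<open>B \<noteq> {}\<close> U(2)] by blast
    have "f \<in> A n" using f U unfolding A_def by blast
    moreover have "f \<in> strong_nbhd B \<epsilon> ?z"
      unfolding strong_nbhd_def using f \<epsilon> U(2) by (auto intro!: exI[of _ "\<delta>/2"])
    ultimately show "\<exists>g\<in>A n. g \<in> strong_nbhd B \<epsilon> ?z" by blast
  qed
  then obtain f where f: "\<And>n. f n \<in> A n" "limitin (strong_topology \<BB>) f ?z sequentially"
    using FU z unfolding strictly_Frechet_Urysohn_def topspace_strong_topology[OF \<BB>] by metis
  obtain u where u: "\<And>n. u n \<in> \<U> n" "\<And>n x. x \<notin> u n \<Longrightarrow> f n x = 1"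
    using f(1) unfolding A_def by (simp add: Bex_def) metis
  have "eventually_enlarging \<BB> u" unfolding eventually_enlarging_def
  proof
    fix B assume "B \<in> \<BB>"
    \<comment> \<open>Radius 1 is the right choice: \<open>f n\<close> equals 1 off
      \<open>u n\<close>, so \<open>\<bar>f n x\<bar> < 1\<close> forces
      \<open>x \<in> u n\<close>.\<close>
    then have "\<forall>\<^sub>F n in sequentially. f n \<in> strong_nbhd B 1 ?z"
      using f(2) unfolding limitin_strong_topology[OF \<BB> z] by simp
    then show "\<forall>\<^sub>F n in sequentially. \<exists>\<delta>>0. enlargement B \<delta> \<subseteq> u n"
    proof (rule eventually_mono)
      fix n assume "f n \<in> strong_nbhd B 1 ?z"
      then obtain \<delta> where \<delta>: "\<delta> > 0" "\<forall>x\<in>enlargement B \<delta>. \<bar>f n x - 0\<bar> < 1"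
        unfolding strong_nbhd_def by blast
      then have "enlargement B \<delta> \<subseteq> u n" using u(2)[of _ n] by force
      then show "\<exists>\<delta>>0. enlargement B \<delta> \<subseteq> u n" using \<delta>(1) by blast
    qed
  qed
  moreover have "open (u n) \<and> u n \<noteq> UNIV" for n
    using U u(1)[of n] unfolding strong_covers_def open_cover_def mem_Collect_eq by metis
  ultimately have "range u \<in> strong_gamma_covers \<BB>"
    by (intro eventually_enlarging_imp_gamma_cover[OF \<BB>]) auto
  then show "\<exists>u. (\<forall>n. u n \<in> \<U> n) \<and> range u \<in> strong_gamma_covers \<BB>" using u(1) by blast
qed

lemma S1_imp_strictly_Frechet_Urysohn:
  assumes \<BB>: "bornology \<BB>" and cl: "has_closed_base \<BB>" and nU: "UNIV \<notin> \<BB>"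
    and L: "strong_Lindelof \<BB>" and S: "S1 (strong_covers \<BB>) (strong_gamma_covers \<BB>)"
  shows "strictly_Frechet_Urysohn (strong_topology \<BB>)"
  unfolding strictly_Frechet_Urysohn_def topspace_strong_topology[OF \<BB>]
proof (intro ballI allI impI)
  fix f and A :: "nat \<Rightarrow> ('a \<Rightarrow> real) set"
  assume f: "f \<in> cont_funs" and A: "\<forall>n. A n \<in> Omega_at (strong_topology \<BB>) f"
  \<comment> \<open>Open subsets of the sets \<open>{x. \<bar>g x - f x\<bar> < 1/(n+1)}\<close> are used because these sets themselves
    may equal \<open>UNIV\<close>, which is not allowed in a strong cover.\<close>
  define \<U> where "\<U> n = {U. open U \<and> U \<noteq> UNIV \<and> (\<exists>g\<in>A n. \<forall>x\<in>U. \<bar>g x - f x\<bar> < 1 / real (Suc n))}" for n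
  have "\<U> n \<in> strong_covers \<BB>" for n
  proof (rule strong_coversI[OF \<BB>])
    fix B assume B: "B \<in> \<BB>"
    have "\<exists>g\<in>A n. g \<in> strong_nbhd B (1 / real (Suc n)) f"
      using A B unfolding Omega_at_strong_topology[OF \<BB> f] by simp
    then obtain g \<delta> where g: "g \<in> A n" "g \<in> cont_funs" "\<delta> > 0"
      "\<forall>x\<in>enlargement B \<delta>. \<bar>g x - f x\<bar> < 1 / real (Suc n)"
      unfolding strong_nbhd_def by blast
    \<comment> \<open>Shrinking the radius below \<eta> keeps the enlargement of \<open>B\<close> a
      proper subset, hence admissible in \<open>\<U> n\<close>.\<close>
    obtain x \<eta> where x: "\<eta> > 0" "x \<notin> enlargement B \<eta>"
      using bornology_enlargement_avoids_point[OF cl nU B] by blast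
    let ?U = "enlargement B (min \<delta> \<eta>)"
    have "x \<notin> ?U" using x enlargement_mono[of B B "min \<delta> \<eta>" \<eta>] by auto
    moreover have "open ?U" unfolding enlargement_def by auto
    moreover have "\<forall>x\<in>?U. \<bar>g x - f x\<bar> < 1 / real (Suc n)"
      using g(4) enlargement_mono[of B B "min \<delta> \<eta>" \<delta>] by auto
    ultimately have "?U \<in> \<U> n" using g(1) unfolding \<U>_def by blast
    moreover have "min \<delta> \<eta> > 0" using g x by simp
    ultimately show "\<exists>U\<in>\<U> n. \<exists>\<delta>>0. enlargement B \<delta> \<subseteq> U" by blast
  qed (auto simp: \<U>_def)
  \<comment> \<open>The order of the selection is essential: the function \<open>g n\<close>
    attached to \<open>u n\<close> has to come from \<open>A n\<close> and obey the bound
    1/(n+1).\<close>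
  then obtain u where u: "\<And>n. u n \<in> \<U> n" "eventually_enlarging \<BB> u"
    using S1_imp_eventually_enlarging_selection[OF \<BB> L S] by metis
  obtain g where g: "\<And>n. g n \<in> A n" "\<And>n x. x \<in> u n \<Longrightarrow> \<bar>g n x - f x\<bar> < 1 / real (Suc n)"
    using u(1) unfolding \<U>_def by (simp add: Bex_def) metis
  have gc: "g n \<in> cont_funs" for n
    using g(1)[of n] A unfolding Omega_at_strong_topology[OF \<BB> f] by blast
  have "limitin (strong_topology \<BB>) g f sequentially"
    unfolding limitin_strong_topology[OF \<BB> f]
  proof (intro ballI allI impI)
    fix B and \<epsilon> :: real assume B: "B \<in> \<BB>" and \<epsilon>: "\<epsilon> > 0"
    have "(\<lambda>n. 1 / real (Suc n)) \<longlonglongrightarrow> 0" using LIMSEQ_inverse_real_of_nat by (simp add: inverse_eq_divide)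
    then have "\<forall>\<^sub>F n in sequentially. 1 / real (Suc n) < \<epsilon>" using \<epsilon> by (rule order_tendstoD)
    moreover have "\<forall>\<^sub>F n in sequentially. \<exists>\<delta>>0. enlargement B \<delta> \<subseteq> u n"
      using u(2) B unfolding eventually_enlarging_def by blast
    ultimately show "\<forall>\<^sub>F n in sequentially. g n \<in> strong_nbhd B \<epsilon> f"
    proof eventually_elim
      case (elim n)
      then obtain \<delta> where \<delta>: "\<delta> > 0" "enlargement B \<delta> \<subseteq> u n" by blast
      have "\<bar>g n x - f x\<bar> < \<epsilon>" if "x \<in> enlargement B \<delta>" for x
        using g(2)[of x n] that \<delta>(2) elim(1) by (meson less_trans subsetD)
      then show ?case using gc \<delta>(1) unfolding strong_nbhd_def by blast
    qed
  qed
  then show "\<exists>a. (\<forall>n. a n \<in> A n) \<and> limitin (strong_topology \<BB>) a f sequentially" using g(1) by blast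
qed

theorem theorem2p6:
  fixes \<BB> :: "'a::metric_space set set"
  assumes "bornology \<BB>"
    and "has_closed_base \<BB>"
    and "UNIV \<notin> \<BB>"
    and "strong_Lindelof \<BB>"
  shows "strictly_Frechet_Urysohn (strong_topology \<BB>) \<longleftrightarrow>
         S1 (strong_covers \<BB>) (strong_gamma_covers \<BB>)"
  using strictly_Frechet_Urysohn_imp_S1 S1_imp_strictly_Frechet_Urysohn assms by blast

end
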